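(* Let $\mathbb{H}$ be a complex Hilbert space and let $T$ be an invertible bounded linear operator on $\mathbb{H}$. Then $T$ is shifted hyperbolic if and only if its $\lambda$-Aluthge transform $\Delta_\lambda(T)$ is shifted hyperbolic for every $\lambda\in(0,1)$.
   Context: - A bounded linear operator $T$ on a Banach space $X$ is generalized hyperbolic if it is invertible (with bounded inverse) and there is a direct sum decomposition $X=M\oplus N$ into complementary closed subspaces such that (i) $T(M)\subset M$ and $T^{-1}(N)\subset N$; (ii) the restrictions $T|_M:M\to M$ and $T^{-1}|_N:N\to N$ have spectral radius $<1$. It is shifted hyperbolic if moreover $T^{-1}(M)\cap N\neq\{0\}$; equivalently, if it is generalized hyperbolic but not hyperbolic, where hyperbolic means that $\sigma(T)$ does not meet the unit circle $\{z\in\mathbb{C}:|z|=1\}$. - For $T\in B(\mathbb{H})$ let $T=U|T|$ be the polar decomposition, where $|T|=(T^*T)^{1/2}$ and $U$ is the unique partial isometry with $\ker U=\ker T=\ker|T|$. For $\lambda\in(0,1)$ the $\lambda$-Aluthge transform is $\Delta_\lambda(T)=|T|^{\lambda}U|T|^{1-\lambda}$. *)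

theory Defs
  imports "HOL-Analysis.Analysis" "HOL-Computational_Algebra.Polynomial"
begin

section \<open>Complex Banach and Hilbert spaces\<close>

class complex_vector = real_vector +
  fixes scaleC :: "complex \<Rightarrow> 'a \<Rightarrow> 'a" (infixr \<open>*\<^sub>C\<close> 75)
  assumes scaleC_add_right: "c *\<^sub>C (x + y) = c *\<^sub>C x + c *\<^sub>C y"
    and scaleC_add_left: "(c + d) *\<^sub>C x = c *\<^sub>C x + d *\<^sub>C x"
    and scaleC_scaleC: "c *\<^sub>C d *\<^sub>C x = (c * d) *\<^sub>C x"
    and scaleC_of_real: "complex_of_real r *\<^sub>C x = r *\<^sub>R x"

class complex_normed_vector = complex_vector + real_normed_vector +
  assumes norm_scaleC: "norm (c *\<^sub>C x) = cmod c * norm x"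

class complex_banach = complex_normed_vector + complete_space

text \<open>The real inner product of a complex inner product space is the real part of the
  complex one. Hence \<^term>\<open>cinner\<close> is positive definite and induces the norm, since
  \<^const>\<open>inner\<close> has these properties.\<close>

class complex_inner = complex_normed_vector + real_inner +
  fixes cinner :: "'a \<Rightarrow> 'a \<Rightarrow> complex"
  assumes cinner_commute: "cinner x y = cnj (cinner y x)"
    and cinner_add_left: "cinner (x + y) z = cinner x z + cinner y z"
    and cinner_scaleC_left: "cinner (c *\<^sub>C x) y = c * cinner x y"
    and Re_cinner: "Re (cinner x y) = inner x y"

class complex_hilbert = complex_inner + complete_space

subclass (in complex_hilbert) complex_banach ..


section \<open>Bounded operators, spectrum and spectral radius\<close>

definition bounded_clinear ::
    "('a::complex_normed_vector \<Rightarrow> 'b::complex_normed_vector) \<Rightarrow> bool" where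
  "bounded_clinear T \<longleftrightarrow> bounded_linear T \<and> (\<forall>c x. T (c *\<^sub>C x) = c *\<^sub>C T x)"

definition csubspace :: "'a::complex_vector set \<Rightarrow> bool" where
  "csubspace M \<longleftrightarrow> subspace M \<and> (\<forall>c. \<forall>x\<in>M. c *\<^sub>C x \<in> M)"

text \<open>For a bounded operator \<open>T\<close> and an invariant closed subspace \<open>M\<close>, the following notions
  are those of the restriction of \<open>T\<close> to an operator from \<open>M\<close> to \<open>M\<close>.\<close>

definition invertible_on :: "'a::complex_normed_vector set \<Rightarrow> ('a \<Rightarrow> 'a) \<Rightarrow> bool" where
  "invertible_on M T \<longleftrightarrow>
     bij_betw T M M \<and> (\<exists>K. \<forall>x\<in>M. norm (inv_into M T x) \<le> K * norm x)"

definition spectrum_on :: "'a::complex_normed_vector set \<Rightarrow> ('a \<Rightarrow> 'a) \<Rightarrow> complex set" where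
  "spectrum_on M T = {z. \<not> invertible_on M (\<lambda>x. T x - z *\<^sub>C x)}"

text \<open>Inserting \<open>0\<close> only matters for \<open>M = {0}\<close>, where the spectrum is empty and the spectral
  radius is \<open>0\<close>; the supremum of the empty set is unspecified on the reals.\<close>

definition spectral_radius_on :: "'a::complex_normed_vector set \<Rightarrow> ('a \<Rightarrow> 'a) \<Rightarrow> real" where
  "spectral_radius_on M T = Sup (insert 0 (cmod ` spectrum_on M T))"

abbreviation invertible_op :: "('a::complex_normed_vector \<Rightarrow> 'a) \<Rightarrow> bool" where
  "invertible_op \<equiv> invertible_on UNIV"

abbreviation spectrum :: "('a::complex_normed_vector \<Rightarrow> 'a) \<Rightarrow> complex set" where
  "spectrum \<equiv> spectrum_on UNIV"


section \<open>Generalized and shifted hyperbolicity\<close>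

definition hyperbolic_splitting ::
    "('a::complex_banach \<Rightarrow> 'a) \<Rightarrow> 'a set \<Rightarrow> 'a set \<Rightarrow> bool" where
  "hyperbolic_splitting T M N \<longleftrightarrow>
     csubspace M \<and> closed M \<and> csubspace N \<and> closed N \<and>
     M \<inter> N = {0} \<and> (\<forall>x. \<exists>m\<in>M. \<exists>n\<in>N. x = m + n) \<and>
     T ` M \<subseteq> M \<and> inv T ` N \<subseteq> N \<and>
     spectral_radius_on M T < 1 \<and> spectral_radius_on N (inv T) < 1"

definition generalized_hyperbolic :: "('a::complex_banach \<Rightarrow> 'a) \<Rightarrow> bool" where
  "generalized_hyperbolic T \<longleftrightarrow>
     bounded_clinear T \<and> invertible_op T \<and> (\<exists>M N. hyperbolic_splitting T M N)"

definition shifted_hyperbolic :: "('a::complex_banach \<Rightarrow> 'a) \<Rightarrow> bool" where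
  "shifted_hyperbolic T \<longleftrightarrow>
     bounded_clinear T \<and> invertible_op T \<and>
     (\<exists>M N. hyperbolic_splitting T M N \<and> inv T ` M \<inter> N \<noteq> {0})"


section \<open>Powers of positive operators and the Aluthge transform\<close>

definition cadjoint :: "('a::complex_hilbert \<Rightarrow> 'a) \<Rightarrow> 'a \<Rightarrow> 'a" where
  "cadjoint T = (THE S. \<forall>x y. cinner (T x) y = cinner x (S y))"

definition poly_op :: "real poly \<Rightarrow> ('a::real_vector \<Rightarrow> 'a) \<Rightarrow> 'a \<Rightarrow> 'a" where
  "poly_op p A x = (\<Sum>i\<le>degree p. coeff p i *\<^sub>R (A ^^ i) x)"

text \<open>The continuous functional calculus of a self-adjoint operator \<open>A\<close>, for \<open>f\<close> continuous on
  the (real) spectrum: \<open>f(A)\<close> is the limit in operator norm of \<open>p\<^sub>n(A)\<close> for all real polynomials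
  \<open>p\<^sub>n\<close> that converge to \<open>f\<close> uniformly on the spectrum.\<close>

definition fun_calc :: "(real \<Rightarrow> real) \<Rightarrow> ('a::complex_hilbert \<Rightarrow> 'a) \<Rightarrow> 'a \<Rightarrow> 'a" where
  "fun_calc f A = (THE B. bounded_clinear B \<and>
     (\<forall>p. uniform_limit {t. complex_of_real t \<in> spectrum A} (\<lambda>n. poly (p n)) f sequentially \<longrightarrow>
          (\<lambda>n. onorm (\<lambda>x. poly_op (p n) A x - B x)) \<longlonglongrightarrow> 0))"

definition op_powr :: "('a::complex_hilbert \<Rightarrow> 'a) \<Rightarrow> real \<Rightarrow> 'a \<Rightarrow> 'a" where
  "op_powr A s = fun_calc (\<lambda>t. t powr s) A"

definition op_abs :: "('a::complex_hilbert \<Rightarrow> 'a) \<Rightarrow> 'a \<Rightarrow> 'a" where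
  "op_abs T = op_powr (cadjoint T \<circ> T) (1/2)"

definition partial_isometry :: "('a::complex_hilbert \<Rightarrow> 'a) \<Rightarrow> bool" where
  "partial_isometry U \<longleftrightarrow> bounded_clinear U \<and>
     (\<forall>x. (\<forall>y. U y = 0 \<longrightarrow> cinner x y = 0) \<longrightarrow> norm (U x) = norm x)"

definition polar_isometry :: "('a::complex_hilbert \<Rightarrow> 'a) \<Rightarrow> 'a \<Rightarrow> 'a" where
  "polar_isometry T = (THE U. partial_isometry U \<and> T = U \<circ> op_abs T \<and>
     {x. U x = 0} = {x. T x = 0})"

definition aluthge :: "real \<Rightarrow> ('a::complex_hilbert \<Rightarrow> 'a) \<Rightarrow> 'a \<Rightarrow> 'a" where
  "aluthge l T = op_powr (op_abs T) l \<circ> polar_isometry T \<circ> op_powr (op_abs T) (1 - l)"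

end

theory Submission
  imports Defs "HOL-Computational_Algebra.Fundamental_Theorem_Algebra"
begin

text \<open>For invertible \<open>T\<close> the operator \<open>\<bar>T\<bar>\<close> is strictly positive and \<open>U = T \<bar>T\<bar>\<^sup>-\<^sup>1\<close>, so
  \<open>\<Delta>\<^sub>\<lambda>(T) = \<bar>T\<bar>\<^sup>\<lambda> U \<bar>T\<bar>\<^sup>1\<^sup>-\<^sup>\<lambda> = \<bar>T\<bar>\<^sup>\<lambda> T \<bar>T\<bar>\<^sup>-\<^sup>\<lambda>\<close> is similar to \<open>T\<close>, and shifted hyperbolicity is invariant
  under similarity.\<close>

section \<open>Bounded operators\<close>

text \<open>The real work is to give meaning to the powers of \<open>op_abs T\<close>:
  \<open>op_powr\<close> is a definite description that ranges over all polynomial sequences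
  approximating \<open>t powr s\<close> on the spectrum. To use it, the limit must be shown to
  exist, to be independent of the sequence and to be multiplicative in the function;
  multiplicativity turns \<open>powr_add\<close> into the group law of the powers and makes negative
  exponents inverses. All of this rests on one estimate: for self-adjoint \<open>A\<close> the norm
  of \<open>poly_op p A\<close> is at most the supremum of the absolute value of \<open>p\<close> on
  the real spectrum. That estimate comes from factoring polynomials over the complex numbers and
  from the invertibility of coercive operators. The hypothesis that \<open>T\<close> is invertible
  enters through a uniform positive lower bound for the quadratic form, which keeps the spectra of
  \<open>cadjoint T \<circ> T\<close> and \<open>op_abs T\<close> away from 0, where
  \<open>t powr s\<close> may fail to be continuous.\<close>

lemma scaleC_zero_left [simp]: "0 *\<^sub>C (x::'a::complex_vector) = 0"
  using scaleC_of_real[of 0 x] by simp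

lemma scaleC_one [simp]: "1 *\<^sub>C (x::'a::complex_vector) = x"
  using scaleC_of_real[of 1 x] by simp

lemma scaleC_zero_right [simp]: "c *\<^sub>C (0::'a::complex_vector) = 0"
  using scaleC_add_right[of c 0 "0::'a"] by simp

lemma scaleC_minus_right [simp]: "c *\<^sub>C (- x) = - (c *\<^sub>C (x::'a::complex_vector))"
  using scaleC_add_right[of c x "- x"] by (simp add: eq_neg_iff_add_eq_0 add.commute)

lemma scaleC_diff_right: "c *\<^sub>C (x - y) = c *\<^sub>C x - c *\<^sub>C (y::'a::complex_vector)"
  using scaleC_add_right[of c x "- y"] by simp

lemma scaleC_minus_left [simp]: "(- c) *\<^sub>C x = - (c *\<^sub>C (x::'a::complex_vector))"
  using scaleC_add_left[of c "- c" x] by (simp add: eq_neg_iff_add_eq_0 add.commute)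

lemma scaleC_scaleR_commute: "c *\<^sub>C r *\<^sub>R x = r *\<^sub>R c *\<^sub>C (x::'a::complex_vector)"
  by (simp flip: scaleC_of_real add: scaleC_scaleC mult.commute)

lemma bounded_linear_scaleC: "bounded_linear (\<lambda>x::'a::complex_normed_vector. c *\<^sub>C x)"
  by (rule bounded_linear_intro[of _ "cmod c"])
    (simp_all add: scaleC_add_right scaleC_scaleR_commute norm_scaleC)

lemma bounded_clinear_bounded_linear: "bounded_clinear T \<Longrightarrow> bounded_linear T"
  by (simp add: bounded_clinear_def)

lemma bounded_clinear_scaleC: "bounded_clinear T \<Longrightarrow> T (c *\<^sub>C x) = c *\<^sub>C T x"
  by (simp add: bounded_clinear_def)

lemma bounded_clinear_add: "bounded_clinear T \<Longrightarrow> T (x + y) = T x + T y"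
  by (simp add: bounded_clinear_def linear_simps)

lemma bounded_clinear_diff: "bounded_clinear T \<Longrightarrow> T (x - y) = T x - T y"
  by (simp add: bounded_clinear_def linear_simps)

lemma bounded_clinear_zero: "bounded_clinear T \<Longrightarrow> T 0 = 0"
  by (simp add: bounded_clinear_def linear_simps)

lemma bounded_clinear_compose:
  assumes "bounded_clinear S" "bounded_clinear T"
  shows "bounded_clinear (\<lambda>x. S (T x))"
  using assms by (auto simp: bounded_clinear_def intro: bounded_linear_compose)

lemma bounded_clinear_plus:
  assumes "bounded_clinear S" "bounded_clinear T"
  shows "bounded_clinear (\<lambda>x. S x + T x)"
  using assms by (auto simp: bounded_clinear_def scaleC_add_right intro: bounded_linear_add)

lemma bounded_clinear_scale: "bounded_clinear (\<lambda>x::'a::complex_normed_vector. c *\<^sub>C x)"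
  by (simp add: bounded_clinear_def bounded_linear_scaleC scaleC_scaleC mult.commute)

lemma bounded_clinear_zero_op:
  "bounded_clinear (\<lambda>x::'a::complex_normed_vector. 0::'b::complex_normed_vector)"
  by (simp add: bounded_clinear_def bounded_linear_zero)

text \<open>Replaces \<open>inv_into\<close> by an arbitrary map that inverts \<open>T\<close> on
  \<open>M\<close>, so that later an inverse can be exhibited instead of computed from a choice
  operator.\<close>

lemma invertible_on_iff:
  "invertible_on M T \<longleftrightarrow> T ` M \<subseteq> M \<and>
     (\<exists>R K. R ` M \<subseteq> M \<and> (\<forall>x\<in>M. R (T x) = x \<and> T (R x) = x \<and> norm (R x) \<le> K * norm x))"
    (is "_ \<longleftrightarrow> ?rhs")
proof
  assume "invertible_on M T"
  then have bij: "bij_betw T M M" and "\<exists>K. \<forall>x\<in>M. norm (inv_into M T x) \<le> K * norm x"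
    by (auto simp: invertible_on_def)
  then obtain K where K: "\<forall>x\<in>M. norm (inv_into M T x) \<le> K * norm x" by blast
  have "inv_into M T ` M \<subseteq> M" "T ` M \<subseteq> M"
    using bij_betw_imp_surj_on[OF bij] bij_betw_imp_surj_on[OF bij_betw_inv_into[OF bij]] by auto
  then show ?rhs
    using K bij_betw_inv_into_left[OF bij] bij_betw_inv_into_right[OF bij] by blast
next
  assume ?rhs
  then obtain R K where T: "T ` M \<subseteq> M" and R: "R ` M \<subseteq> M" and
    inv: "\<And>x. x \<in> M \<Longrightarrow> R (T x) = x \<and> T (R x) = x \<and> norm (R x) \<le> K * norm x" by blast
  have bij: "bij_betw T M M"
    using T R inv by (intro bij_betw_byWitness[where f' = R]) auto
  have "inv_into M T x = R x" if "x \<in> M" for x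
    using inv[OF that] R that bij by (metis bij_betw_def image_subset_iff inv_into_f_f)
  then show "invertible_on M T"
    using bij inv by (auto simp: invertible_on_def)
qed

lemma invertible_opI:
  assumes "\<And>x. R (T x) = x" "\<And>x. T (R x) = x" "\<And>x. norm (R x) \<le> K * norm x"
  shows "invertible_op T"
  unfolding invertible_on_iff using assms by blast

lemma invertible_opE:
  assumes "invertible_op T"
  obtains K where "\<And>x. norm (inv T x) \<le> K * norm x" "\<And>x. inv T (T x) = x" "\<And>x. T (inv T x) = x"
  using assms unfolding invertible_on_def
  by (metis UNIV_I bij_betw_inv_into_left bij_betw_inv_into_right)

lemma inv_op_eq:
  assumes "\<And>x. R (T x) = x" "\<And>x. T (R x) = x"
  shows "inv T = R"
  using assms by (metis inv_equality)

lemma invertible_op_compose: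
  assumes "invertible_op S" "invertible_op T"
  shows "invertible_op (\<lambda>x. S (T x))"
proof -
  obtain K where K: "\<And>x. norm (inv S x) \<le> K * norm x" "\<And>x. inv S (S x) = x" "\<And>x. S (inv S x) = x"
    using invertible_opE[OF assms(1)] by blast
  obtain L where L: "\<And>x. norm (inv T x) \<le> L * norm x" "\<And>x. inv T (T x) = x" "\<And>x. T (inv T x) = x"
    using invertible_opE[OF assms(2)] by blast
  \<comment> \<open>The bounds \<open>K\<close> and \<open>L\<close> carry no sign condition (on the
    zero space any real number will do), so absolute values are taken before multiplying.\<close>
  have "norm (inv T (inv S x)) \<le> (\<bar>L\<bar> * \<bar>K\<bar>) * norm x" for x
  proof -
    have "norm (inv T (inv S x)) \<le> \<bar>L\<bar> * norm (inv S x)"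
      using L(1)[of "inv S x"] by (meson abs_ge_self mult_right_mono norm_ge_zero order_trans)
    also have "\<dots> \<le> \<bar>L\<bar> * (\<bar>K\<bar> * norm x)"
      using K(1)[of x] by (intro mult_left_mono)
       (meson abs_ge_self mult_right_mono norm_ge_zero order_trans, simp)
    finally show ?thesis by (simp add: mult.assoc)
  qed
  then show ?thesis
    using K L by (intro invertible_opI[where R = "\<lambda>x. inv T (inv S x)"]) auto
qed

lemma invertible_op_scaleC:
  "c \<noteq> 0 \<Longrightarrow> invertible_op (\<lambda>x::'a::complex_normed_vector. c *\<^sub>C x)"
  by (rule invertible_opI[where R = "\<lambda>x. inverse c *\<^sub>C x" and K = "cmod (inverse c)"])
    (simp_all add: scaleC_scaleC norm_scaleC)

section \<open>Invariance under similarity\<close>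

text \<open>The image of \<open>M\<close> under \<open>S\<close> is its preimage under the
  continuous inverse \<open>R\<close>.\<close>

lemma closed_image_iso:
  assumes "bounded_linear R" and "\<And>x. R (S x) = x" "\<And>x. S (R x) = x" and "closed M"
  shows "closed (S ` M)"
proof -
  have "S ` M = R -` M"
    using assms(2,3) by (auto intro: rev_image_eqI)
  then show ?thesis
    using assms(1,4) by (simp add: continuous_closed_vimage linear_continuous_at)
qed

lemma csubspace_image:
  assumes "bounded_clinear S" "csubspace M"
  shows "csubspace (S ` M)"
  unfolding csubspace_def
proof (intro conjI allI ballI)
  show "subspace (S ` M)"
    using assms by (auto simp: csubspace_def bounded_clinear_def
        intro: linear_subspace_image bounded_linear.linear)
  show "c *\<^sub>C y \<in> S ` M" if "y \<in> S ` M" for c y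
    using that assms by (auto simp: csubspace_def simp flip: bounded_clinear_scaleC)
qed

lemma invertible_on_similar:
  assumes S: "bounded_clinear S" and R: "bounded_clinear R"
    and RS: "\<And>x. R (S x) = x" and SR: "\<And>x. S (R x) = x"
    and inv: "invertible_on M T"
  shows "invertible_on (S ` M) (\<lambda>x. S (T (R x)))"
proof -
  obtain Q K where T: "T ` M \<subseteq> M" and Q: "Q ` M \<subseteq> M" and
    inv: "\<And>x. x \<in> M \<Longrightarrow> Q (T x) = x \<and> T (Q x) = x \<and> norm (Q x) \<le> K * norm x"
    using inv unfolding invertible_on_iff by blast
  have bound: "norm (S (Q x)) \<le> (onorm S * \<bar>K\<bar> * onorm R) * norm (S x)" if "x \<in> M" for x
  proof -
    have "norm (S (Q x)) \<le> onorm S * norm (Q x)"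
      using S by (simp add: onorm bounded_clinear_bounded_linear)
    also have "\<dots> \<le> onorm S * (\<bar>K\<bar> * norm x)"
      using inv[OF that] S
      by (intro mult_left_mono onorm_pos_le bounded_clinear_bounded_linear)
       (meson abs_ge_self mult_right_mono norm_ge_zero order_trans, simp)
    also have "\<dots> \<le> onorm S * (\<bar>K\<bar> * (onorm R * norm (S x)))"
      using onorm[OF bounded_clinear_bounded_linear[OF R], of "S x"] S
      by (intro mult_left_mono onorm_pos_le bounded_clinear_bounded_linear) (simp_all add: RS)
    finally show ?thesis by (simp add: mult.assoc)
  qed
  show ?thesis
    unfolding invertible_on_iff
  proof (intro conjI exI ballI)
    show "(\<lambda>x. S (T (R x))) ` S ` M \<subseteq> S ` M" "(\<lambda>x. S (Q (R x))) ` S ` M \<subseteq> S ` M"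
      using T Q by (auto simp: RS)
    fix y assume "y \<in> S ` M"
    then obtain x where x: "x \<in> M" "y = S x" by blast
    then show "S (Q (R (S (T (R y))))) = y" "S (T (R (S (Q (R y))))) = y"
      "norm (S (Q (R y))) \<le> (onorm S * \<bar>K\<bar> * onorm R) * norm y"
      using inv[of x] bound[of x] by (auto simp: RS)
  qed
qed

lemma invertible_on_similar_iff:
  assumes S: "bounded_clinear S" and R: "bounded_clinear R"
    and RS: "\<And>x. R (S x) = x" and SR: "\<And>x. S (R x) = x"
  shows "invertible_on (S ` M) (\<lambda>x. S (T (R x))) \<longleftrightarrow> invertible_on M T"
proof
  assume "invertible_on (S ` M) (\<lambda>x. S (T (R x)))"
  then have "invertible_on (R ` S ` M) (\<lambda>x. R (S (T (R (S x)))))"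
    by (rule invertible_on_similar[OF R S SR RS])
  then show "invertible_on M T"
    by (simp add: RS image_image)
qed (rule invertible_on_similar[OF S R RS SR])

text \<open>Subtracting \<open>z\<close> commutes with conjugation by \<open>S\<close>, so already
  the spectra coincide as sets.\<close>

lemma spectral_radius_on_similar:
  assumes S: "bounded_clinear S" and R: "bounded_clinear R"
    and RS: "\<And>x. R (S x) = x" and SR: "\<And>x. S (R x) = x"
  shows "spectral_radius_on (S ` M) (\<lambda>x. S (T (R x))) = spectral_radius_on M T"
proof -
  have "S (T (R x)) - z *\<^sub>C x = S (T (R x) - z *\<^sub>C R x)" for x z
    using S by (simp add: bounded_clinear_diff bounded_clinear_scaleC SR)
  then have "spectrum_on (S ` M) (\<lambda>x. S (T (R x))) = spectrum_on M T"
    using invertible_on_similar_iff[OF assms, where T = "\<lambda>x. T x - _ *\<^sub>C x"]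
    by (simp add: spectrum_on_def)
  then show ?thesis by (simp add: spectral_radius_on_def)
qed

text \<open>The formula for \<open>inv T'\<close> is a hypothesis because it comes from bijectivity
  of \<open>T\<close>, which \<open>hyperbolic_splitting\<close> does not contain.\<close>

lemma hyperbolic_splitting_similar:
  assumes S: "bounded_clinear S" and R: "bounded_clinear R"
    and RS: "\<And>x. R (S x) = x" and SR: "\<And>x. S (R x) = x"
    and inv: "inv T' = (\<lambda>x. S (inv T (R x)))" and T': "T' = (\<lambda>x. S (T (R x)))"
    and split: "hyperbolic_splitting T M N"
  shows "hyperbolic_splitting T' (S ` M) (S ` N)"
proof -
  have MN: "M \<inter> N = {0}" and sum: "\<And>x. \<exists>m\<in>M. \<exists>n\<in>N. x = m + n"
    and inv_MN: "T ` M \<subseteq> M" "inv T ` N \<subseteq> N"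
    using split by (auto simp: hyperbolic_splitting_def)
  have "S ` M \<inter> S ` N = S ` (M \<inter> N)"
    by (metis RS image_Int inj_on_inverseI)
  then have 1: "S ` M \<inter> S ` N = {0}"
    using S by (simp add: MN bounded_clinear_zero)
  have 2: "\<exists>m\<in>S ` M. \<exists>n\<in>S ` N. x = m + n" for x
    using sum[of "R x"] bounded_clinear_add[OF S] SR by (metis imageI)
  have 3: "T' ` S ` M \<subseteq> S ` M" "inv T' ` S ` N \<subseteq> S ` N"
    using inv_MN unfolding inv unfolding T' by (auto simp: RS)
  show ?thesis
    using split 1 2 3 unfolding hyperbolic_splitting_def
    unfolding inv unfolding T' spectral_radius_on_similar[OF S R RS SR]
    by (simp add: csubspace_image[OF S] closed_image_iso[OF bounded_clinear_bounded_linear[OF R] RS SR])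
qed

lemma shifted_hyperbolic_similar:
  assumes S: "bounded_clinear S" and R: "bounded_clinear R"
    and RS: "\<And>x. R (S x) = x" and SR: "\<And>x. S (R x) = x"
    and T: "shifted_hyperbolic T"
  shows "shifted_hyperbolic (\<lambda>x. S (T (R x)))"
proof -
  let ?T = "\<lambda>x. S (T (R x))"
  obtain M N where lin: "bounded_clinear T" and inv: "invertible_op T"
    and split: "hyperbolic_splitting T M N" and shift: "inv T ` M \<inter> N \<noteq> {0}"
    using T by (auto simp: shifted_hyperbolic_def)
  have inv_eq: "inv ?T = (\<lambda>x. S (inv T (R x)))"
    by (rule inv_op_eq; rule invertible_opE[OF inv]; simp add: RS SR)
  have "invertible_op ?T"
    using invertible_on_similar[OF S R RS SR inv] RS SR by (metis surjI)
  moreover have "bounded_clinear ?T"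
    by (intro bounded_clinear_compose[OF S] bounded_clinear_compose[OF lin] R)
  moreover have "inv ?T ` S ` M \<inter> S ` N \<noteq> {0}"
  proof
    assume *: "inv ?T ` S ` M \<inter> S ` N = {0}"
    have "inv ?T ` S ` M \<inter> S ` N = S ` (inv T ` M \<inter> N)"
      using inj_on_image_Int[OF inj_on_inverseI, of UNIV R S "inv T ` M" N]
      by (simp add: inv_eq RS image_image)
    then have "R ` S ` (inv T ` M \<inter> N) = R ` {0}"
      using * by metis
    with shift show False by (simp add: image_image RS bounded_clinear_zero[OF R])
  qed
  ultimately show ?thesis
    using hyperbolic_splitting_similar[OF S R RS SR inv_eq refl split]
    unfolding shifted_hyperbolic_def by blast
qed

lemma shifted_hyperbolic_similar_iff:
  assumes S: "bounded_clinear S" and R: "bounded_clinear R"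
    and RS: "\<And>x. R (S x) = x" and SR: "\<And>x. S (R x) = x"
  shows "shifted_hyperbolic (\<lambda>x. S (T (R x))) \<longleftrightarrow> shifted_hyperbolic T"
  using shifted_hyperbolic_similar[OF assms, of T]
    shifted_hyperbolic_similar[OF R S SR RS, of "\<lambda>x. S (T (R x))"]
  by (auto simp: RS)

section \<open>Operators on Hilbert spaces\<close>

lemma inner_scaleC_left: "inner (c *\<^sub>C x) y = inner x (cnj c *\<^sub>C (y::'a::complex_inner))"
proof -
  have "cinner x (cnj c *\<^sub>C y) = c * cinner x y"
    by (subst cinner_commute, subst cinner_scaleC_left, subst cinner_commute) simp
  then show ?thesis
    by (simp flip: Re_cinner add: cinner_scaleC_left)
qed

lemma Im_cinner: "Im (cinner x y) = inner x (\<i> *\<^sub>C (y::'a::complex_inner))"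
proof -
  have "inner x (\<i> *\<^sub>C y) = inner ((- \<i>) *\<^sub>C x) y"
    unfolding inner_scaleC_left by simp
  also have "\<dots> = Im (cinner x y)"
    unfolding Re_cinner[symmetric] cinner_scaleC_left by simp
  finally show ?thesis ..
qed

text \<open>The imaginary part of \<open>cinner\<close> at \<open>y\<close> is its real part at
  \<open>\<i> *\<^sub>C y\<close>. Adjoints can therefore be found and tested with the real
  \<open>inner\<close>, while \<open>cadjoint\<close> is described by \<open>cinner\<close>.\<close>

lemma cinner_eq_iff_inner_eq:
  assumes "\<And>y. S (\<i> *\<^sub>C y) = \<i> *\<^sub>C S (y::'a::complex_inner)"
  shows "(\<forall>y. cinner u y = cinner x (S y)) \<longleftrightarrow> (\<forall>y. inner u y = inner x (S y))"
  unfolding complex_eq_iff Im_cinner Re_cinner assms[symmetric] by blast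

text \<open>Variational proof: the representing vector is the minimizer of \<open>J\<close>, since
  the derivative of \<open>J\<close> at \<open>y\<close> in direction \<open>h\<close> is
  \<open>2 * (inner h y - f h)\<close>.\<close>

theorem riesz_representation:
  fixes f :: "'a::{real_inner, complete_space} \<Rightarrow> real"
  assumes f: "bounded_linear f"
  obtains y where "\<And>x. f x = inner x y"
proof -
  interpret f: bounded_linear f by fact
  obtain K where K: "\<And>x. norm (f x) \<le> norm x * K"
    using f.bounded by blast
  define J where "J x = (norm x)\<^sup>2 - 2 * f x" for x
  define m where "m = Inf (range J)"
  have J_ge: "J x \<ge> - K\<^sup>2" for x
  proof -
    have "J x \<ge> (norm x - K)\<^sup>2 - K\<^sup>2"
      using K[of x] by (simp add: J_def power2_diff)
    then show ?thesis by (smt (verit) zero_le_power2)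
  qed
  then have bdd: "bdd_below (range J)" by (rule bdd_belowI2)
  then have m_le: "m \<le> J x" for x
    unfolding m_def using bdd by (intro cInf_lower) auto
  \<comment> \<open>Parallelogram law, with the midpoint value of \<open>J\<close> bounded below by
    \<open>m\<close>: near-minimizers are close to each other, so a minimizing sequence is
    Cauchy.\<close>
  have near: "(norm (x - y))\<^sup>2 \<le> 2 * (J x - m) + 2 * (J y - m)" for x y
  proof -
    have "(norm (x - y))\<^sup>2 = 2 * J x + 2 * J y - 4 * J ((1/2) *\<^sub>R (x + y))"
      unfolding J_def power2_norm_eq_inner f.scaleR f.add
      by (simp add: inner_simps algebra_simps inner_commute)
    then show ?thesis using m_le[of "(1/2) *\<^sub>R (x + y)"] by simp
  qed
  have "\<exists>x. J x < m + inverse (real (Suc n))" for n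
    using bdd cINF_less_iff[of UNIV J "m + inverse (real (Suc n))"] by (simp add: m_def)
  then obtain X where X: "\<And>n. J (X n) < m + inverse (real (Suc n))" by metis
  have "Cauchy X"
  proof (rule metric_CauchyI)
    fix e :: real assume "e > 0"
    then obtain N where N: "inverse (real (Suc N)) < e\<^sup>2 / 4"
      using reals_Archimedean[of "e\<^sup>2 / 4"] by auto
    have "dist (X i) (X j) < e" if "i \<ge> N" "j \<ge> N" for i j
    proof -
      have "inverse (real (Suc i)) \<le> inverse (real (Suc N))" 
        "inverse (real (Suc j)) \<le> inverse (real (Suc N))"
        using that by (auto intro: le_imp_inverse_le)
      then have "J (X i) - m < e\<^sup>2 / 4" "J (X j) - m < e\<^sup>2 / 4"
        using X[of i] X[of j] N by linarith+
      then have "(norm (X i - X j))\<^sup>2 < e\<^sup>2"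
        using near[of "X i" "X j"] by argo
      then show ?thesis
        unfolding dist_norm by (rule power2_less_imp_less) (use \<open>e > 0\<close> in simp)
    qed
    then show "\<exists>N. \<forall>i\<ge>N. \<forall>j\<ge>N. dist (X i) (X j) < e" by blast
  qed
  then obtain y where y: "X \<longlonglongrightarrow> y"
    using Cauchy_convergent convergent_def by blast
  have "(\<lambda>n. J (X n)) \<longlonglongrightarrow> J y"
    unfolding J_def using y by (intro tendsto_intros f.tendsto)
  moreover have "(\<lambda>n. m + inverse (real (Suc n))) \<longlonglongrightarrow> m + 0"
    by (intro tendsto_intros LIMSEQ_inverse_real_of_nat)
  ultimately have "J y \<le> m + 0"
    using X less_imp_le by (intro LIMSEQ_le) blast+
  then have min: "J y \<le> J x" for x using m_le[of x] by simp
  have "f h = inner h y" for h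
  proof -
    define b where "b = inner h y - f h"
    define a where "a = (norm h)\<^sup>2"
    have a: "a \<ge> 0" by (simp add: a_def)
    have var: "0 \<le> t\<^sup>2 * a + 2 * t * b" for t
      using min[of "y + t *\<^sub>R h"]
      unfolding J_def a_def b_def power2_norm_eq_inner f.scaleR f.add
      by (simp add: inner_simps algebra_simps inner_commute power2_eq_square)
    \<comment> \<open>The quadratic in \<open>t\<close> has its minimum at \<open>- b / a\<close>;
      dividing by \<open>a + 1\<close> instead covers \<open>h = 0\<close> and still makes the value
      negative unless \<open>b = 0\<close>.\<close>
    define s where "s = a + 1"
    have s: "s > 0" using a by (simp add: s_def)
    have "0 \<le> s\<^sup>2 * ((- b / s)\<^sup>2 * a + 2 * (- b / s) * b)"
      using var[of "- b / s"] by simp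
    also have "\<dots> = b\<^sup>2 * a - 2 * s * b\<^sup>2"
      using s by (simp add: power2_eq_square field_simps)
    also have "\<dots> = - (a + 2) * b\<^sup>2"
      by (simp add: s_def algebra_simps)
    finally have "b\<^sup>2 \<le> 0" using a by (simp add: zero_le_mult_iff mult_le_0_iff)
    then show ?thesis by (simp add: b_def)
  qed
  then show thesis by (rule that)
qed

text \<open>Riesz gives \<open>S y\<close> for each \<open>y\<close> separately. Linearity follows
  because inner products with all \<open>x\<close> determine a vector, and the bound from testing
  the identity at \<open>x = S y\<close>.\<close>

lemma cadjoint_exists:
  fixes T :: "'a::complex_hilbert \<Rightarrow> 'a"
  assumes T: "bounded_clinear T"
  shows "\<exists>S. bounded_clinear S \<and> (\<forall>x y. inner (T x) y = inner x (S y))"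
proof -
  have "\<exists>s. \<forall>x. inner (T x) y = inner x s" for y
    by (metis riesz_representation bounded_linear_inner_left_comp
        bounded_clinear_bounded_linear[OF T])
  then obtain S where S: "\<And>x y. inner (T x) y = inner x (S y)" by metis
  have ext: "u = v" if "\<And>x. inner x u = inner x v" for u v :: 'a
    using that by (metis vector_eq_rdot inner_commute)
  have "S (c *\<^sub>C y) = c *\<^sub>C S y" for c y
    by (rule ext)
      (metis S T bounded_clinear_scaleC complex_cnj_cnj inner_scaleC_left)
  moreover have "S (x + y) = S x + S y" for x y
    by (rule ext) (simp add: inner_add_right flip: S)
  moreover have "S (r *\<^sub>R y) = r *\<^sub>R S y" for r y
    by (rule ext) (simp flip: S)
  moreover have "norm (S y) \<le> norm y * onorm T" for y
  proof -
    have "norm (S y) * norm (S y) = inner (T (S y)) y"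
      by (simp add: S power2_norm_eq_inner flip: power2_eq_square)
    also have "\<dots> \<le> norm (T (S y)) * norm y" by (rule norm_cauchy_schwarz)
    also have "\<dots> \<le> (onorm T * norm (S y)) * norm y"
      by (intro mult_right_mono onorm bounded_clinear_bounded_linear T norm_ge_zero)
    finally have "norm (S y) * norm (S y) \<le> norm (S y) * (norm y * onorm T)"
      by (simp add: mult_ac)
    then show ?thesis
      using onorm_pos_le[OF bounded_clinear_bounded_linear[OF T]]
      by (cases "norm (S y) = 0") (auto simp: mult_le_cancel_left)
  qed
  ultimately have "bounded_clinear S"
    unfolding bounded_clinear_def by (blast intro: bounded_linear_intro)
  then show ?thesis using S by blast
qed

lemma
  fixes T :: "'a::complex_hilbert \<Rightarrow> 'a"
  assumes T: "bounded_clinear T"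
  shows bounded_clinear_cadjoint: "bounded_clinear (cadjoint T)"
    and inner_cadjoint: "inner (T x) y = inner x (cadjoint T y)"
proof -
  obtain S where S: "bounded_clinear S" "\<And>x y. inner (T x) y = inner x (S y)"
    using cadjoint_exists[OF T] by blast
  have "cadjoint T = S"
    unfolding cadjoint_def
  proof (rule the_equality)
    show "\<forall>x y. cinner (T x) y = cinner x (S y)"
      using cinner_eq_iff_inner_eq[of S] S by (metis bounded_clinear_scaleC)
    fix S' assume "\<forall>x y. cinner (T x) y = cinner x (S' y)"
    then have "inner x (S' y) = inner x (S y)" for x y
      by (metis Re_cinner S(2))
    then show "S' = S" by (metis ext vector_eq_rdot inner_commute)
  qed
  then show "bounded_clinear (cadjoint T)" "inner (T x) y = inner x (cadjoint T y)"
    using S by auto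
qed

text \<open>The Lax--Milgram lemma: \<open>x \<mapsto> x - \<tau> (B x - y)\<close> is a contraction for small \<open>\<tau> > 0\<close>.\<close>

theorem coercive_imp_invertible_op:
  fixes B :: "'a::complex_hilbert \<Rightarrow> 'a"
  assumes B: "bounded_linear B" and c: "c > 0"
    and coercive: "\<And>x. c * (norm x)\<^sup>2 \<le> inner (B x) x"
  shows "invertible_op B"
proof -
  interpret B: bounded_linear B by fact
  \<comment> \<open>The summand \<open>c\<close> gives \<open>K \<ge> c > 0\<close> on every space,
    including the zero space, so that the radicand of \<open>q\<close> is nonnegative.\<close>
  define K where "K = onorm B + c"
  have K: "K > 0" "K \<ge> c" and BK: "norm (B x) \<le> K * norm x" for x
    using onorm_pos_le[OF B] c onorm[OF B, of x]
    by (auto simp: K_def distrib_right intro: add_increasing2)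
  \<comment> \<open>The minimizer of \<open>1 - 2 * t * c + t\<^sup>2 * K\<^sup>2\<close>, the
    factor in the estimate of \<open>contr\<close>; its minimum is \<open>q\<^sup>2\<close>.\<close>
  define t where "t = c / K\<^sup>2"
  have t: "t > 0" using c K by (simp add: t_def)
  define q where "q = sqrt (1 - c\<^sup>2 / K\<^sup>2)"
  have q_sq: "0 \<le> 1 - c\<^sup>2 / K\<^sup>2" using c K by (simp add: power_mono)
  have q: "0 \<le> q" "q < 1"
    using q_sq c K by (auto simp: q_def)
  have contr: "norm (x - t *\<^sub>R B x) \<le> q * norm x" for x
  proof (rule power2_le_imp_le)
    have "(norm (x - t *\<^sub>R B x))\<^sup>2 = (norm x)\<^sup>2 - 2 * t * inner (B x) x + t\<^sup>2 * (norm (B x))\<^sup>2"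
      unfolding power2_norm_eq_inner
      by (simp add: inner_simps algebra_simps inner_commute power2_eq_square)
    also have "\<dots> \<le> (norm x)\<^sup>2 - 2 * t * (c * (norm x)\<^sup>2) + t\<^sup>2 * (K * norm x)\<^sup>2"
      using coercive[of x] t BK[of x]
      by (intro add_mono diff_mono mult_left_mono power_mono) auto
    also have "\<dots> = (1 - c\<^sup>2 / K\<^sup>2) * (norm x)\<^sup>2"
      using K by (simp add: t_def power2_eq_square field_simps)
    also have "\<dots> = (q * norm x)\<^sup>2"
      using q_sq by (simp add: q_def power_mult_distrib)
    finally show "(norm (x - t *\<^sub>R B x))\<^sup>2 \<le> (q * norm x)\<^sup>2" .
  qed (use q in simp)
  have "\<exists>x. B x = y" for y
  proof -
    have "dist (x - t *\<^sub>R (B x - y)) (z - t *\<^sub>R (B z - y)) \<le> q * dist x z" for x z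
      using contr[of "x - z"] by (simp add: dist_norm B.diff algebra_simps)
    then have "\<exists>!x. x - t *\<^sub>R (B x - y) = x"
      by (intro banach_fix_type[OF q]) blast
    then show ?thesis using t by auto
  qed
  then obtain R where R: "\<And>y. B (R y) = y" by metis
  have below: "c * norm x \<le> norm (B x)" for x
  proof -
    have "c * norm x * norm x \<le> norm (B x) * norm x"
      using coercive[of x] norm_cauchy_schwarz[of "B x" x] by (simp add: power2_eq_square mult_ac)
    then show ?thesis by (cases "x = 0") (auto simp: B.zero)
  qed
  have inj: "x = y" if "B x = B y" for x y
    using below[of "x - y"] that c by (simp add: B.diff mult_le_0_iff)
  show ?thesis
  proof (rule invertible_opI)
    show "norm (R x) \<le> inverse c * norm x" for x
      using below[of "R x"] c R by (simp add: field_simps)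
  qed (auto intro: inj R)
qed

section \<open>Self-adjoint operators and the location of their spectrum\<close>

definition self_adjoint :: "('a::complex_inner \<Rightarrow> 'a) \<Rightarrow> bool" where
  "self_adjoint A \<longleftrightarrow> bounded_clinear A \<and> (\<forall>x y. inner (A x) y = inner x (A y))"

text \<open>The uniform constant \<open>c\<close> matters in infinite dimension: a form that is
  merely positive on nonzero vectors can have 0 in the spectrum.\<close>

definition strictly_positive :: "('a::complex_inner \<Rightarrow> 'a) \<Rightarrow> bool" where
  "strictly_positive A \<longleftrightarrow> self_adjoint A \<and> (\<exists>c>0. \<forall>x. c * (norm x)\<^sup>2 \<le> inner (A x) x)"

lemma self_adjoint_bounded_clinear: "self_adjoint A \<Longrightarrow> bounded_clinear A"
  by (simp add: self_adjoint_def)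

lemma self_adjoint_inner: "self_adjoint A \<Longrightarrow> inner (A x) y = inner x (A y)"
  by (simp add: self_adjoint_def)

abbreviation real_spectrum :: "('a::complex_normed_vector \<Rightarrow> 'a) \<Rightarrow> real set" where
  "real_spectrum A \<equiv> {t. complex_of_real t \<in> spectrum A}"

text \<open>Coercivity sees only the real part of the complex form. The factor \<open>d\<close>
  rotates a form that stays away from 0 on another side: \<open>d\<close> is plus or minus
  \<open>\<i>\<close> for nonreal \<open>z\<close>, and -1 or 1 for real numbers above or below the
  form.\<close>

lemma invertible_op_if_coercive_scaleC:
  fixes B :: "'a::complex_hilbert \<Rightarrow> 'a"
  assumes B: "bounded_clinear B" and "c > 0" "d \<noteq> 0"
    and "\<And>x. c * (norm x)\<^sup>2 \<le> inner (d *\<^sub>C B x) x"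
  shows "invertible_op B"
proof -
  have "invertible_op (\<lambda>x. d *\<^sub>C B x)"
    using assms bounded_linear_compose[OF bounded_linear_scaleC, of B d]
    by (intro coercive_imp_invertible_op[of _ c]) (auto simp: bounded_clinear_def)
  from invertible_op_compose[OF invertible_op_scaleC this, of "inverse d"]
  show ?thesis using \<open>d \<noteq> 0\<close> by (simp add: scaleC_scaleC)
qed

lemma bounded_clinear_minus_scaleC:
  "bounded_clinear A \<Longrightarrow> bounded_clinear (\<lambda>x. A x - z *\<^sub>C x)"
  using bounded_clinear_plus[OF _ bounded_clinear_scale[of "- z"], of A] by simp

lemma self_adjoint_spectrum_real:
  fixes A :: "'a::complex_hilbert \<Rightarrow> 'a"
  assumes A: "self_adjoint A" and z: "z \<in> spectrum A"
  shows "z \<in> \<real>"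
proof (rule ccontr)
  assume "z \<notin> \<real>"
  then have Im: "Im z \<noteq> 0" by (simp add: complex_is_Real_iff)
  \<comment> \<open>The form of a self-adjoint \<open>A\<close> is real, so only \<open>- z\<close>
    contributes to the real part after rotation by plus or minus \<open>\<i>\<close>; the sign makes
    that contribution \<open>\<bar>Im z\<bar>\<close>.\<close>
  define d where "d = of_real (sgn (Im z)) * \<i>"
  have lin: "bounded_clinear A" using A by (rule self_adjoint_bounded_clinear)
  have 0: "inner (\<i> *\<^sub>C y) (y::'a) = 0" for y
    using inner_scaleC_left[of \<i> y y] by (simp add: inner_commute)
  have i: "inner (\<i> *\<^sub>C A x) x = 0" for x
    using inner_scaleC_left[of \<i> "A x" x] self_adjoint_inner[OF A, of x "\<i> *\<^sub>C x"]
      bounded_clinear_scaleC[OF lin, of \<i> x] by (simp add: inner_commute)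
  have "\<bar>Im z\<bar> * (norm x)\<^sup>2 \<le> inner (d *\<^sub>C (A x - z *\<^sub>C x)) x" for x
  proof -
    have "d * z = of_real (sgn (Im z) * Re z) * \<i> - of_real \<bar>Im z\<bar>"
      by (auto simp: d_def complex_eq_iff abs_sgn mult.commute)
    then have "d *\<^sub>C (A x - z *\<^sub>C x)
      = sgn (Im z) *\<^sub>R (\<i> *\<^sub>C A x) - ((sgn (Im z) * Re z) *\<^sub>R (\<i> *\<^sub>C x) + (- \<bar>Im z\<bar>) *\<^sub>R x)"
      unfolding scaleC_diff_right scaleC_scaleC
      by (simp only: d_def scaleC_of_real[symmetric] scaleC_scaleC scaleC_add_left[symmetric])
        (simp add: algebra_simps)
    then show ?thesis
      by (simp add: inner_simps i 0 power2_norm_eq_inner)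
  qed
  then have "invertible_op (\<lambda>x. A x - z *\<^sub>C x)"
    using Im by (intro invertible_op_if_coercive_scaleC[of _ "\<bar>Im z\<bar>" d]
        bounded_clinear_minus_scaleC lin) (auto simp: d_def sgn_zero_iff)
  then show False using z by (simp add: spectrum_on_def)
qed

lemma real_spectrum_upper_bound:
  fixes A :: "'a::complex_hilbert \<Rightarrow> 'a"
  assumes A: "bounded_clinear A" and upper: "\<And>x. inner (A x) x \<le> b * (norm x)\<^sup>2"
    and t: "t \<in> real_spectrum A"
  shows "t \<le> b"
proof (rule ccontr)
  assume "\<not> t \<le> b"
  then have "invertible_op (\<lambda>x. A x - of_real t *\<^sub>C x)"
    using upper
    by (intro invertible_op_if_coercive_scaleC[of _ "t - b" "-1"] bounded_clinear_minus_scaleC A)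
      (auto simp: scaleC_of_real inner_simps algebra_simps power2_norm_eq_inner)
  then show False using t by (simp add: spectrum_on_def)
qed

lemma real_spectrum_lower_bound:
  fixes A :: "'a::complex_hilbert \<Rightarrow> 'a"
  assumes A: "bounded_clinear A" and lower: "\<And>x. a * (norm x)\<^sup>2 \<le> inner (A x) x"
    and t: "t \<in> real_spectrum A"
  shows "a \<le> t"
proof (rule ccontr)
  assume "\<not> a \<le> t"
  then have "invertible_op (\<lambda>x. A x - of_real t *\<^sub>C x)"
    using lower
    by (intro invertible_op_if_coercive_scaleC[of _ "a - t" 1] bounded_clinear_minus_scaleC A)
      (auto simp: scaleC_of_real inner_simps algebra_simps power2_norm_eq_inner)
  then show False using t by (simp add: spectrum_on_def)
qed

lemma strictly_positive_real_spectrum: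
  fixes A :: "'a::complex_hilbert \<Rightarrow> 'a"
  assumes "strictly_positive A"
  obtains a b where "a > 0" "real_spectrum A \<subseteq> {a..b}"
proof -
  obtain c where c: "c > 0" "\<And>x. c * (norm x)\<^sup>2 \<le> inner (A x) x"
    using assms by (auto simp: strictly_positive_def)
  have lin: "bounded_clinear A"
    using assms by (auto simp: strictly_positive_def self_adjoint_def)
  have "inner (A x) x \<le> onorm A * (norm x)\<^sup>2" for x
  proof -
    have "inner (A x) x \<le> norm (A x) * norm x" by (rule norm_cauchy_schwarz)
    also have "\<dots> \<le> (onorm A * norm x) * norm x"
      by (intro mult_right_mono onorm bounded_clinear_bounded_linear lin norm_ge_zero)
    finally show ?thesis by (simp add: power2_eq_square mult_ac)
  qed
  then show thesis
    using real_spectrum_upper_bound[OF lin] real_spectrum_lower_bound[OF lin c(2)]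
    by (intro that[of c "onorm A"] c(1)) auto
qed

section \<open>Polynomials of an operator\<close>

lemma scaleC_sum_right: "c *\<^sub>C sum f S = (\<Sum>i\<in>S. c *\<^sub>C (f i :: 'a::complex_vector))"
  by (induction S rule: infinite_finite_induct) (simp_all add: scaleC_add_right)

text \<open>Complex coefficients, unlike those of \<open>poly_op\<close>, allow the splitting into
  linear factors.\<close>

definition cpoly_op :: "complex poly \<Rightarrow> ('a::complex_vector \<Rightarrow> 'a) \<Rightarrow> 'a \<Rightarrow> 'a" where
  "cpoly_op p A x = (\<Sum>i\<le>degree p. coeff p i *\<^sub>C (A ^^ i) x)"

lemma cpoly_op_eq_sum:
  assumes "degree p \<le> n"
  shows "cpoly_op p A x = (\<Sum>i\<le>n. coeff p i *\<^sub>C (A ^^ i) x)"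
  unfolding cpoly_op_def
  using assms by (intro sum.mono_neutral_left) (auto simp: coeff_eq_0)

lemma cpoly_op_0 [simp]: "cpoly_op 0 A x = 0"
  by (simp add: cpoly_op_def)

lemma cpoly_op_pCons:
  assumes A: "bounded_clinear A"
  shows "cpoly_op (pCons a p) A x = a *\<^sub>C x + A (cpoly_op p A x)"
proof -
  have "cpoly_op (pCons a p) A x = a *\<^sub>C x + (\<Sum>i\<le>degree p. coeff p i *\<^sub>C A ((A ^^ i) x))"
    unfolding cpoly_op_eq_sum[OF degree_pCons_le] sum.atMost_Suc_shift by simp
  then show ?thesis
    using A by (simp add: cpoly_op_def bounded_clinear_scaleC
        linear_sum[OF bounded_linear.linear] bounded_clinear_bounded_linear)
qed

lemma bounded_clinear_cpoly_op: "bounded_clinear A \<Longrightarrow> bounded_clinear (cpoly_op p A)"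
proof (induction p)
  case 0
  then show ?case using bounded_clinear_zero_op by (simp add: cpoly_op_def[abs_def])
next
  case (pCons a p)
  then have "bounded_clinear (\<lambda>x. a *\<^sub>C x + A (cpoly_op p A x))"
    using bounded_clinear_plus[OF bounded_clinear_scale bounded_clinear_compose] by blast
  moreover have "cpoly_op (pCons a p) A = (\<lambda>x. a *\<^sub>C x + A (cpoly_op p A x))"
    using pCons.prems by (simp add: fun_eq_iff cpoly_op_pCons)
  ultimately show ?case by simp
qed

lemma cpoly_op_add: "cpoly_op (p + q) A x = cpoly_op p A x + cpoly_op q A x"
  by (simp add: cpoly_op_eq_sum[of _ "max (degree p) (degree q)"] degree_add_le
      scaleC_add_left sum.distrib)

lemma cpoly_op_smult: "cpoly_op (smult c p) A x = c *\<^sub>C cpoly_op p A x"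
  by (simp add: cpoly_op_eq_sum[of _ "degree p"] scaleC_scaleC degree_smult_le
      scaleC_sum_right)

lemma cpoly_op_mult:
  assumes "bounded_clinear A"
  shows "cpoly_op (p * q) A x = cpoly_op p A (cpoly_op q A x)"
  using assms by (induction p) (simp_all add: cpoly_op_add cpoly_op_smult cpoly_op_pCons)

text \<open>The half of the spectral mapping theorem that is needed: every root of \<open>q\<close>
  lies outside the spectrum, so each linear factor gives an invertible operator and so does their
  composition.\<close>

lemma invertible_op_cpoly_op:
  fixes A :: "'a::complex_normed_vector \<Rightarrow> 'a"
  assumes A: "bounded_clinear A"
  shows "q \<noteq> 0 \<Longrightarrow> (\<And>z. z \<in> spectrum A \<Longrightarrow> poly q z \<noteq> 0) \<Longrightarrow> invertible_op (cpoly_op q A)"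
proof (induction "degree q" arbitrary: q)
  case 0
  then obtain c where "q = [:c:]" by (metis degree_eq_zeroE)
  then have "cpoly_op q A = (\<lambda>x. c *\<^sub>C x)" "c \<noteq> 0"
    using 0 A by (auto simp: cpoly_op_pCons bounded_clinear_zero fun_eq_iff)
  then show ?case by (simp add: invertible_op_scaleC)
next
  case (Suc n)
  then obtain z where z: "poly q z = 0"
    using fundamental_theorem_of_algebra[of q] by (auto simp: constant_degree)
  then obtain r where q: "q = [:- z, 1:] * r"
    by (auto simp: poly_eq_0_iff_dvd)
  then have "r \<noteq> 0" using Suc.prems(1) by auto
  then have "degree q = Suc (degree r)" unfolding q by (subst degree_mult_eq) auto
  then have "invertible_op (cpoly_op r A)"
    using Suc.hyps \<open>r \<noteq> 0\<close> Suc.prems(2) by (auto simp: q)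
  moreover have "invertible_op (\<lambda>x. A x - z *\<^sub>C x)"
    using z Suc.prems(2) by (auto simp: spectrum_on_def)
  ultimately have "invertible_op (\<lambda>x. A (cpoly_op r A x) - z *\<^sub>C cpoly_op r A x)"
    by (rule invertible_op_compose[rotated])
  moreover have "cpoly_op q A = (\<lambda>x. A (cpoly_op r A x) - z *\<^sub>C cpoly_op r A x)"
    using A unfolding q cpoly_op_mult[OF A, abs_def]
    by (simp add: fun_eq_iff cpoly_op_pCons bounded_clinear_zero cpoly_op_add cpoly_op_smult cpoly_op_mult)
  ultimately show ?case by simp
qed

lemma poly_op_eq_cpoly_op:
  "poly_op p A x = cpoly_op (map_poly complex_of_real p) A (x::'a::complex_vector)"
  by (simp add: poly_op_def cpoly_op_def degree_map_poly coeff_map_poly scaleC_of_real)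

lemma map_poly_of_real_mult:
  "map_poly complex_of_real (p * q) = map_poly of_real p * map_poly of_real q"
  by (rule poly_eqI) (simp add: coeff_map_poly coeff_mult)

lemma map_poly_of_real_diff:
  "map_poly complex_of_real (p - q) = map_poly of_real p - map_poly of_real q"
  by (rule poly_eqI) (simp add: coeff_map_poly)

lemma poly_map_poly_of_real: "poly (map_poly complex_of_real p) (of_real t) = of_real (poly p t)"
  by (induction p) (auto simp: map_poly_pCons)

lemma bounded_clinear_poly_op:
  "bounded_clinear A \<Longrightarrow> bounded_clinear (poly_op p (A :: 'a::complex_normed_vector \<Rightarrow> 'a))"
  unfolding poly_op_eq_cpoly_op[abs_def] by (rule bounded_clinear_cpoly_op)

context
  fixes A :: "'a::complex_normed_vector \<Rightarrow> 'a"
  assumes A: "bounded_clinear A"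
begin

lemma poly_op_pCons: "poly_op (pCons a p) A x = a *\<^sub>R x + A (poly_op p A x)"
  by (simp add: poly_op_eq_cpoly_op map_poly_pCons cpoly_op_pCons[OF A] scaleC_of_real)

lemma poly_op_0 [simp]: "poly_op 0 A x = 0"
  by (simp add: poly_op_eq_cpoly_op)

lemma poly_op_mult: "poly_op (p * q) A x = poly_op p A (poly_op q A x)"
  by (simp add: poly_op_eq_cpoly_op map_poly_of_real_mult cpoly_op_mult[OF A])

lemma poly_op_diff: "poly_op (p - q) A x = poly_op p A x - poly_op q A x"
  using cpoly_op_add[of "map_poly of_real (p - q)" "map_poly of_real q" A x]
  by (simp add: poly_op_eq_cpoly_op map_poly_of_real_diff)

lemma poly_op_X: "poly_op [:0, 1:] A x = A x"
  using A by (simp add: poly_op_pCons bounded_clinear_zero)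

lemma poly_op_const: "poly_op [:c:] A x = c *\<^sub>R x"
  using A by (simp add: poly_op_pCons bounded_clinear_zero)

end

lemma self_adjoint_poly_op:
  assumes A: "self_adjoint A"
  shows "self_adjoint (poly_op p A)"
proof -
  have lin: "bounded_clinear A" using A by (rule self_adjoint_bounded_clinear)
  have "inner (poly_op p A x) y = inner x (poly_op p A y)" for x y
  proof (induction p arbitrary: x y)
    case (pCons a p)
    have "A (poly_op p A y) = poly_op p A (A y)"
      using poly_op_mult[OF lin, of "[:0, 1:]" p y] poly_op_mult[OF lin, of p "[:0, 1:]" y]
      by (simp add: poly_op_X[OF lin] mult.commute)
    then show ?case
      by (simp add: poly_op_pCons[OF lin] inner_simps self_adjoint_inner[OF A] pCons.IH)
  qed (simp add: poly_op_0[OF lin])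
  then show ?thesis
    by (simp add: self_adjoint_def bounded_clinear_poly_op[OF lin])
qed

section \<open>Continuous functional calculus\<close>

text \<open>If \<open>N = \<parallel>p(A)\<parallel>\<close> exceeded \<open>\<bar>p\<bar>\<close> on the spectrum, then \<open>p\<^sup>2 - N\<^sup>2\<close> would have no zero there, so
  \<open>p(A)\<^sup>2 - N\<^sup>2\<close> would be invertible, hence bounded below. For self-adjoint \<open>p(A)\<close> this forces
  \<open>\<parallel>p(A) x\<parallel>\<close> to stay away from \<open>N \<parallel>x\<parallel>\<close>.\<close>

lemma onorm_poly_op_le_nonconstant:
  fixes A :: "'a::complex_hilbert \<Rightarrow> 'a"
  assumes A: "self_adjoint A" and p: "degree p > 0" and M: "M \<ge> 0"
    and bound: "\<And>t. t \<in> real_spectrum A \<Longrightarrow> \<bar>poly p t\<bar> \<le> M"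
  shows "onorm (poly_op p A) \<le> M"
proof (rule ccontr)
  have lin: "bounded_clinear A" using A by (rule self_adjoint_bounded_clinear)
  define N where "N = onorm (poly_op p A)"
  define q where "q = p * p - [:N\<^sup>2:]"
  assume "\<not> onorm (poly_op p A) \<le> M"
  then have N: "N > M" by (simp add: N_def)
  have PN: "norm (poly_op p A x) \<le> N * norm x" for x
    unfolding N_def
    by (intro onorm bounded_clinear_bounded_linear bounded_clinear_poly_op lin)
  \<comment> \<open>A constant \<open>p\<close> could make \<open>q\<close> zero; the bound on the
    spectrum would exclude this only if the spectrum were known to be nonempty.\<close>
  have "degree (p * p) \<noteq> 0" using p by (subst degree_mult_eq) auto
  then have "q \<noteq> 0" by (auto simp: q_def)
  then have "map_poly complex_of_real q \<noteq> 0"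
    by (subst map_poly_eq_0_iff) auto
  moreover have "poly (map_poly complex_of_real q) z \<noteq> 0" if z: "z \<in> spectrum A" for z
  proof -
    obtain t where t: "z = complex_of_real t"
      using self_adjoint_spectrum_real[OF A z] by (auto elim: Reals_cases)
    then have "\<bar>poly p t\<bar> < N" using bound[of t] z N by auto
    then have "(poly p t)\<^sup>2 \<noteq> N\<^sup>2"
      by (smt (verit) power2_eq_iff)
    then have "poly q t \<noteq> 0" by (simp add: q_def power2_eq_square)
    then show ?thesis by (simp add: t poly_map_poly_of_real)
  qed
  ultimately have "invertible_op (cpoly_op (map_poly complex_of_real q) A)"
    by (rule invertible_op_cpoly_op[OF lin])
  then have inv: "invertible_op (poly_op q A)"
    by (simp add: poly_op_eq_cpoly_op[abs_def])
  obtain K where K: "\<And>x. norm (inv (poly_op q A) x) \<le> K * norm x"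
      "\<And>x. inv (poly_op q A) (poly_op q A x) = x"
    by (rule invertible_opE[OF inv]) (rule that)
  define k where "k = \<bar>K\<bar> + 1"
  have k: "k > 0" "K \<le> k" by (auto simp: k_def)
  define d where "d = inverse (k\<^sup>2)"
  have d: "d > 0" using k by (simp add: d_def)
  have below: "d * (norm x)\<^sup>2 \<le> (norm (poly_op q A x))\<^sup>2" for x
  proof -
    have "norm x \<le> K * norm (poly_op q A x)"
      using K(1)[of "poly_op q A x"] K(2)[of x] by simp
    also have "\<dots> \<le> k * norm (poly_op q A x)"
      using k by (intro mult_right_mono) auto
    finally have "(norm x)\<^sup>2 \<le> (k * norm (poly_op q A x))\<^sup>2"
      by (intro power_mono) auto
    then show ?thesis
      using k by (simp add: d_def power_mult_distrib field_simps)
  qed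
  \<comment> \<open>Expand the square of \<open>P\<^sup>2 x - N\<^sup>2 x\<close> for
    \<open>P = poly_op p A\<close>: self-adjointness turns the mixed term into the squared norm of
    \<open>P x\<close>, and the leading term is bounded by applying \<open>PN\<close> to
    \<open>P x\<close>.\<close>
  have upper: "(norm (poly_op q A x))\<^sup>2 \<le> N\<^sup>2 * (N\<^sup>2 * (norm x)\<^sup>2 - (norm (poly_op p A x))\<^sup>2)" for x
  proof -
    let ?P = "poly_op p A"
    have q_eq: "poly_op q A x = ?P (?P x) - N\<^sup>2 *\<^sub>R x"
      by (simp add: q_def poly_op_diff[OF lin] poly_op_mult[OF lin] poly_op_const[OF lin])
    have "inner (?P (?P x)) x = (norm (?P x))\<^sup>2"
      by (simp add: self_adjoint_inner[OF self_adjoint_poly_op[OF A]] power2_norm_eq_inner)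
    then have "(norm (poly_op q A x))\<^sup>2
        = (norm (?P (?P x)))\<^sup>2 - 2 * N\<^sup>2 * (norm (?P x))\<^sup>2 + N\<^sup>2 * N\<^sup>2 * (norm x)\<^sup>2"
      unfolding q_eq power2_norm_eq_inner
      by (simp add: inner_simps algebra_simps inner_commute)
    moreover have "(norm (?P (?P x)))\<^sup>2 \<le> N\<^sup>2 * (norm (?P x))\<^sup>2"
      using power_mono[OF PN[of "?P x"], of 2] by (simp add: power_mult_distrib)
    ultimately show ?thesis by (simp add: algebra_simps)
  qed
  \<comment> \<open>Solving \<open>below\<close> and \<open>upper\<close> for the norm of
    \<open>poly_op p A x\<close> gives the factor \<open>N\<^sup>2 - d / N\<^sup>2\<close>, strictly
    less than \<open>N\<^sup>2\<close>; the \<open>max\<close> makes the root usable without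
    discussing its sign.\<close>
  define r where "r = sqrt (max 0 (N\<^sup>2 - d / N\<^sup>2))"
  have N2: "N\<^sup>2 > 0" using N M by simp
  have "N \<le> r"
    unfolding N_def
  proof (rule onorm_bound)
    show "norm (poly_op p A x) \<le> r * norm x" for x
    proof (rule power2_le_imp_le)
      have "d * (norm x)\<^sup>2 \<le> N\<^sup>2 * (N\<^sup>2 * (norm x)\<^sup>2 - (norm (poly_op p A x))\<^sup>2)"
        using below upper by (rule order_trans)
      then have "(norm (poly_op p A x))\<^sup>2 \<le> (N\<^sup>2 - d / N\<^sup>2) * (norm x)\<^sup>2"
        using N2 by (simp add: field_simps)
      also have "\<dots> \<le> (max 0 (N\<^sup>2 - d / N\<^sup>2)) * (norm x)\<^sup>2"
        by (intro mult_right_mono) auto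
      also have "\<dots> = (r * norm x)\<^sup>2"
        by (simp add: r_def power_mult_distrib)
      finally show "(norm (poly_op p A x))\<^sup>2 \<le> (r * norm x)\<^sup>2" .
    qed (simp add: r_def)
  qed (simp add: r_def)
  then have "N\<^sup>2 \<le> r\<^sup>2" using N M by (intro power_mono) auto
  moreover have "d / N\<^sup>2 > 0" using N2 d by simp
  ultimately show False using N2 by (simp add: r_def max_def split: if_splits)
qed

text \<open>For a constant polynomial a spectral point settles the claim. If there is none, the
  nonconstant case for the polynomial \<open>[:0, 1:]\<close> with bound 0 forces
  \<open>A = 0\<close>; since 0 is not in the spectrum, the zero map is injective and the space is
  trivial.\<close>

lemma onorm_poly_op_le:
  fixes A :: "'a::complex_hilbert \<Rightarrow> 'a"
  assumes A: "self_adjoint A" and M: "M \<ge> 0"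
    and bound: "\<And>t. t \<in> real_spectrum A \<Longrightarrow> \<bar>poly p t\<bar> \<le> M"
  shows "onorm (poly_op p A) \<le> M"
proof (cases "degree p > 0")
  case True
  then show ?thesis using onorm_poly_op_le_nonconstant[OF A _ M bound] by blast
next
  case False
  have lin: "bounded_clinear A" using A by (rule self_adjoint_bounded_clinear)
  obtain c where p: "p = [:c:]" using False by (metis degree_eq_zeroE gr0I)
  show ?thesis
  proof (cases "real_spectrum A = {}")
    case False
    then have "\<bar>c\<bar> \<le> M" using bound by (auto simp: p)
    then show ?thesis
      by (intro onorm_bound M) (auto simp: p poly_op_const[OF lin] intro: mult_right_mono)
  next
    case True
    then have "onorm (poly_op [:0, 1:] A) \<le> 0"
      by (intro onorm_poly_op_le_nonconstant[OF A]) auto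
    moreover have "poly_op [:0, 1:] A = A"
      by (simp add: fun_eq_iff poly_op_X[OF lin])
    ultimately have "onorm A = 0"
      using onorm_pos_le[OF bounded_clinear_bounded_linear[OF lin]] by simp
    then have A0: "A x = 0" for x
      using onorm_eq_0[OF bounded_clinear_bounded_linear[OF lin]] by simp
    have "invertible_op (\<lambda>x. A x - of_real 0 *\<^sub>C x)"
      using True unfolding spectrum_on_def by blast
    then have "inj (\<lambda>x::'a. 0::'a)"
      by (simp add: A0 invertible_on_def bij_betw_def)
    then have "x = 0" for x :: 'a by (simp add: inj_def)
    then show ?thesis
      by (intro onorm_bound M) (metis M mult_nonneg_nonneg norm_ge_zero norm_zero)
  qed
qed

\<comment> \<open>Weierstrass approximation and limits of polynomials of an operator\<close>
subclass (in complex_banach) banach ..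

lemma uniform_poly_approximation:
  fixes f :: "real \<Rightarrow> real"
  assumes f: "continuous_on {a..b} f"
  obtains p where "uniform_limit {a..b} (\<lambda>n. poly (p n)) f sequentially"
proof -
  have "\<exists>q. \<forall>x\<in>{a..b}. \<bar>f x - poly q x\<bar> < inverse (real (Suc n))" for n
  proof -
    obtain g where g: "real_polynomial_function g"
        "\<And>x. x \<in> {a..b} \<Longrightarrow> \<bar>f x - g x\<bar> < inverse (real (Suc n))"
      using Stone_Weierstrass_real_polynomial_function[OF compact_Icc f, of "inverse (real (Suc n))"]
      by auto
    then obtain c m where "g = (\<lambda>x. \<Sum>i\<le>m. c i * x ^ i)"
      by (auto simp: real_polynomial_function_iff_sum)
    then have "poly (\<Sum>i\<le>m. monom (c i) i) = g"
      by (simp add: fun_eq_iff poly_sum poly_monom)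
    then show ?thesis using g by metis
  qed
  then obtain p where p: "\<And>n x. x \<in> {a..b} \<Longrightarrow> \<bar>f x - poly (p n) x\<bar> < inverse (real (Suc n))"
    by metis
  have "uniform_limit {a..b} (\<lambda>n. poly (p n)) f sequentially"
  proof (rule uniform_limitI)
    fix e :: real assume "e > 0"
    with LIMSEQ_inverse_real_of_nat have "\<forall>\<^sub>F n in sequentially. inverse (real (Suc n)) < e"
      by (rule order_tendstoD)
    then show "\<forall>\<^sub>F n in sequentially. \<forall>x\<in>{a..b}. dist (poly (p n) x) (f x) < e"
    proof eventually_elim
      case (elim n)
      then show ?case
        using p[of _ n] by (metis abs_minus_commute dist_real_def less_trans)
    qed
  qed
  then show thesis by (rule that)
qed

text \<open>Functions are taken continuous on a compact interval around the spectrum, where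
  Weierstrass approximation and boundedness are at hand; convergence is measured on the spectrum
  only.\<close>

locale spectral_interval =
  fixes A :: "'a::complex_hilbert \<Rightarrow> 'a" and a b :: real
  assumes self_adjoint: "self_adjoint A" and spectrum_subset: "real_spectrum A \<subseteq> {a..b}"
begin

lemma lin: "bounded_clinear A"
  using self_adjoint by (rule self_adjoint_bounded_clinear)

lemma bounded_linear_poly_op: "bounded_linear (poly_op p A)"
  by (intro bounded_clinear_bounded_linear bounded_clinear_poly_op lin)

text \<open>The norm estimate, moved to the Banach space of bounded operators so that uniform Cauchy
  sequences of polynomials yield convergent operators.\<close>

lemma dist_Blinfun_poly_op_le:
  assumes "M \<ge> 0" "\<And>t. t \<in> real_spectrum A \<Longrightarrow> \<bar>poly p t - poly q t\<bar> \<le> M"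
  shows "dist (Blinfun (poly_op p A)) (Blinfun (poly_op q A)) \<le> M"
proof -
  have "dist (Blinfun (poly_op p A)) (Blinfun (poly_op q A)) = onorm (poly_op (p - q) A)"
    by (simp add: dist_norm norm_blinfun.rep_eq minus_blinfun.rep_eq bounded_linear_poly_op
        bounded_linear_Blinfun_apply poly_op_diff[OF lin, abs_def])
  also have "\<dots> \<le> M" using assms by (intro onorm_poly_op_le self_adjoint) auto
  finally show ?thesis .
qed

lemma
  assumes f: "continuous_on {a..b} f"
  shows bounded_clinear_fun_calc: "bounded_clinear (fun_calc f A)"
    and fun_calc_limit: "uniform_limit (real_spectrum A) (\<lambda>n. poly (p n)) f sequentially
      \<Longrightarrow> (\<lambda>n. onorm (\<lambda>x. poly_op (p n) A x - fun_calc f A x)) \<longlonglongrightarrow> 0"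
proof -
  let ?S = "real_spectrum A"
  let ?F = "\<lambda>p. Blinfun (poly_op p A)"
  let ?conv = "\<lambda>p. uniform_limit ?S (\<lambda>n. poly (p n)) f sequentially"
  \<comment> \<open>This sequence produces the limit \<open>G\<close> and later its uniqueness:
    without any approximating sequence the condition in \<open>fun_calc\<close> would hold vacuously
    for every \<open>B\<close>.\<close>
  obtain p0 where "uniform_limit {a..b} (\<lambda>n. poly (p0 n)) f sequentially"
    using uniform_poly_approximation[OF f] by blast
  then have p0: "?conv p0"
    using spectrum_subset by (rule uniform_limit_on_subset)
  have "Cauchy (\<lambda>n. ?F (p0 n))"
  proof (rule metric_CauchyI)
    fix e :: real assume e: "e > 0"
    have "uniformly_Cauchy_on ?S (\<lambda>n. poly (p0 n))"
      using p0 by (intro uniformly_convergent_Cauchy uniformly_convergentI)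
    then obtain N where "\<forall>x\<in>?S. \<forall>m\<ge>N. \<forall>n\<ge>N. dist (poly (p0 m) x) (poly (p0 n) x) < e / 2"
      using e unfolding uniformly_Cauchy_on_def by (meson half_gt_zero)
    then have "dist (?F (p0 m)) (?F (p0 n)) \<le> e / 2" if "m \<ge> N" "n \<ge> N" for m n
      using that e by (intro dist_Blinfun_poly_op_le) (auto simp: dist_real_def intro: less_imp_le)
    then show "\<exists>N. \<forall>m\<ge>N. \<forall>n\<ge>N. dist (?F (p0 m)) (?F (p0 n)) < e"
      using e by (intro exI[of _ N]) (smt (verit) half_gt_zero field_sum_of_halves)
  qed
  then obtain G where G: "(\<lambda>n. ?F (p0 n)) \<longlonglongrightarrow> G"
    using Cauchy_convergent convergent_def by blast
  \<comment> \<open>\<open>fun_calc\<close> quantifies over all approximating sequences, so the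
    limit along \<open>p0\<close> must be shown to be the limit along each of them.\<close>
  have conv: "(\<lambda>n. ?F (p n)) \<longlonglongrightarrow> G" if p: "?conv p" for p
  proof -
    have "(\<lambda>n. dist (?F (p n)) (?F (p0 n))) \<longlonglongrightarrow> 0"
    proof (rule tendstoI)
      fix e :: real assume e: "e > 0"
      then have "\<forall>\<^sub>F n in sequentially. \<forall>x\<in>?S. dist (poly (p0 n) x) (f x) < e / 3"
        "\<forall>\<^sub>F n in sequentially. \<forall>x\<in>?S. dist (poly (p n) x) (f x) < e / 3"
        using uniform_limitD[OF p0, of "e / 3"] uniform_limitD[OF p, of "e / 3"] by auto
      then show "\<forall>\<^sub>F n in sequentially. dist (dist (?F (p n)) (?F (p0 n))) 0 < e"
      proof eventually_elim
        case (elim n)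
        have "dist (?F (p n)) (?F (p0 n)) \<le> 2 * e / 3"
        proof (rule dist_Blinfun_poly_op_le)
          fix t assume "t \<in> ?S"
          then have "\<bar>poly (p0 n) t - f t\<bar> < e / 3" "\<bar>poly (p n) t - f t\<bar> < e / 3"
            using elim by (auto simp: dist_real_def)
          then show "\<bar>poly (p n) t - poly (p0 n) t\<bar> \<le> 2 * e / 3" by argo
        qed (use e in simp)
        then show ?case using e by simp
      qed
    qed
    then have "(\<lambda>n. ?F (p n) - ?F (p0 n)) \<longlonglongrightarrow> 0"
      by (simp add: dist_norm tendsto_norm_zero_iff)
    with G show ?thesis by (rule Lim_transform)
  qed
  have onorm_eq: "onorm (\<lambda>x. poly_op p A x - blinfun_apply B x) = dist (?F p) B" for p B
    by (simp add: dist_norm norm_blinfun.rep_eq minus_blinfun.rep_eq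
        bounded_linear_Blinfun_apply bounded_linear_poly_op)
  have limit: "(\<lambda>n. onorm (\<lambda>x. poly_op (p n) A x - blinfun_apply G x)) \<longlonglongrightarrow> 0" if "?conv p" for p
    unfolding onorm_eq using iffD1[OF tendsto_dist_iff conv[OF that]] .
  \<comment> \<open>\<open>blinfun\<close> records real linearity only; complex homogeneity has to
    be passed to the limit.\<close>
  have "blinfun_apply G (c *\<^sub>C x) = c *\<^sub>C blinfun_apply G x" for c x
  proof (rule LIMSEQ_unique)
    have *: "(\<lambda>n. poly_op (p0 n) A x) \<longlonglongrightarrow> blinfun_apply G x" for x
      using blinfun.tendsto[OF G tendsto_const[of x]] bounded_linear_poly_op
      by (simp add: bounded_linear_Blinfun_apply)
    show "(\<lambda>n. poly_op (p0 n) A (c *\<^sub>C x)) \<longlonglongrightarrow> blinfun_apply G (c *\<^sub>C x)" by (rule *)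
    have "(\<lambda>n. c *\<^sub>C poly_op (p0 n) A x) \<longlonglongrightarrow> c *\<^sub>C blinfun_apply G x"
      by (intro bounded_linear.tendsto[OF bounded_linear_scaleC] *)
    then show "(\<lambda>n. poly_op (p0 n) A (c *\<^sub>C x)) \<longlonglongrightarrow> c *\<^sub>C blinfun_apply G x"
      by (simp add: bounded_clinear_scaleC[OF bounded_clinear_poly_op[OF lin]])
  qed
  then have Glin: "bounded_clinear (blinfun_apply G)"
    by (simp add: bounded_clinear_def blinfun.bounded_linear_right)
  have "fun_calc f A = blinfun_apply G"
    unfolding fun_calc_def
  proof (rule the_equality)
    fix B
    assume B: "bounded_clinear B \<and> (\<forall>p. ?conv p \<longrightarrow>
      (\<lambda>n. onorm (\<lambda>x. poly_op (p n) A x - B x)) \<longlonglongrightarrow> 0)"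
    then have Bapp: "blinfun_apply (Blinfun B) = B"
      by (simp add: bounded_linear_Blinfun_apply bounded_clinear_bounded_linear)
    have "(\<lambda>n. onorm (\<lambda>x. poly_op (p0 n) A x - blinfun_apply (Blinfun B) x)) \<longlonglongrightarrow> 0"
      using B p0 unfolding Bapp by blast
    then have "(\<lambda>n. ?F (p0 n)) \<longlonglongrightarrow> Blinfun B"
      unfolding onorm_eq by (rule iffD2[OF tendsto_dist_iff])
    with G have "G = Blinfun B" by (rule LIMSEQ_unique)
    then show "B = blinfun_apply G" using Bapp by simp
  qed (use Glin limit in blast)
  then show "bounded_clinear (fun_calc f A)"
    "?conv p \<Longrightarrow> (\<lambda>n. onorm (\<lambda>x. poly_op (p n) A x - fun_calc f A x)) \<longlonglongrightarrow> 0"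
    using Glin limit by simp_all
qed

lemma fun_calc_tendsto:
  assumes f: "continuous_on {a..b} f"
    and p: "uniform_limit (real_spectrum A) (\<lambda>n. poly (p n)) f sequentially"
  shows "(\<lambda>n. poly_op (p n) A x) \<longlonglongrightarrow> fun_calc f A x"
proof -
  have lim: "(\<lambda>n. onorm (\<lambda>x. poly_op (p n) A x - fun_calc f A x) * norm x) \<longlonglongrightarrow> 0"
    using tendsto_mult_left_zero[OF fun_calc_limit[OF assms]] .
  have "norm (poly_op (p n) A x - fun_calc f A x)
      \<le> onorm (\<lambda>x. poly_op (p n) A x - fun_calc f A x) * norm x" for n
    by (rule onorm) (intro bounded_linear_sub bounded_linear_poly_op
        bounded_clinear_bounded_linear bounded_clinear_fun_calc f)
  then have "(\<lambda>n. poly_op (p n) A x - fun_calc f A x) \<longlonglongrightarrow> 0"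
    by (intro Lim_null_comparison[OF _ lim] always_eventually) auto
  then show ?thesis by (rule LIM_zero_cancel)
qed

lemma spectrum_poly_approximation:
  assumes "continuous_on {a..b} f"
  obtains p where "uniform_limit (real_spectrum A) (\<lambda>n. poly (p n)) f sequentially"
proof -
  obtain p where "uniform_limit {a..b} (\<lambda>n. poly (p n)) f sequentially"
    using uniform_poly_approximation[OF assms] by blast
  then have "uniform_limit (real_spectrum A) (\<lambda>n. poly (p n)) f sequentially"
    using spectrum_subset by (rule uniform_limit_on_subset)
  then show thesis by (rule that)
qed

lemma self_adjoint_fun_calc:
  assumes f: "continuous_on {a..b} f"
  shows "self_adjoint (fun_calc f A)"
proof -
  obtain p where "uniform_limit (real_spectrum A) (\<lambda>n. poly (p n)) f sequentially"
    using spectrum_poly_approximation[OF f] by blast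
  note p = fun_calc_tendsto[OF f this]
  have "inner (fun_calc f A x) y = inner x (fun_calc f A y)" for x y
  proof (rule LIMSEQ_unique)
    show "(\<lambda>n. inner (poly_op (p n) A x) y) \<longlonglongrightarrow> inner (fun_calc f A x) y"
      by (intro tendsto_inner p tendsto_const)
    show "(\<lambda>n. inner (poly_op (p n) A x) y) \<longlonglongrightarrow> inner x (fun_calc f A y)"
      unfolding self_adjoint_inner[OF self_adjoint_poly_op[OF self_adjoint]]
      by (intro tendsto_inner p tendsto_const)
  qed
  then show ?thesis
    by (simp add: self_adjoint_def bounded_clinear_fun_calc[OF f])
qed

lemma fun_calc_mult:
  assumes f: "continuous_on {a..b} f" and g: "continuous_on {a..b} g"
  shows "fun_calc f A (fun_calc g A x) = fun_calc (\<lambda>t. f t * g t) A x"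
proof -
  obtain p where p: "uniform_limit (real_spectrum A) (\<lambda>n. poly (p n)) f sequentially"
    using spectrum_poly_approximation[OF f] by blast
  obtain q where q: "uniform_limit (real_spectrum A) (\<lambda>n. poly (q n)) g sequentially"
    using spectrum_poly_approximation[OF g] by blast
  have "bounded (h ` real_spectrum A)" if "continuous_on {a..b} h" for h :: "real \<Rightarrow> real"
    using compact_imp_bounded[OF compact_continuous_image[OF that compact_Icc]]
    by (rule bounded_subset) (use spectrum_subset in blast)
  then have "uniform_limit (real_spectrum A) (\<lambda>n t. poly (p n) t * poly (q n) t)
      (\<lambda>t. f t * g t) sequentially"
    using f g by (intro uniform_lim_mult p q)
  then have "uniform_limit (real_spectrum A) (\<lambda>n. poly (p n * q n)) (\<lambda>t. f t * g t) sequentially"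
    by (simp add: poly_mult[abs_def])
  then have pq: "(\<lambda>n. poly_op (p n * q n) A x) \<longlonglongrightarrow> fun_calc (\<lambda>t. f t * g t) A x"
    by (intro fun_calc_tendsto continuous_on_mult f g)
  \<comment> \<open>Tested weakly, the factor \<open>poly_op (p n) A\<close> moves to
    \<open>y\<close>, so that the limits of the two factors are taken in separate arguments of
    \<open>inner\<close>.\<close>
  have "inner (fun_calc f A (fun_calc g A x)) y = inner (fun_calc (\<lambda>t. f t * g t) A x) y" for y
  proof (rule LIMSEQ_unique)
    show "(\<lambda>n. inner (poly_op (p n * q n) A x) y) \<longlonglongrightarrow> inner (fun_calc (\<lambda>t. f t * g t) A x) y"
      by (intro tendsto_inner pq tendsto_const)
    have "inner (poly_op (p n * q n) A x) y = inner (poly_op (q n) A x) (poly_op (p n) A y)" for n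
      by (simp only: poly_op_mult[OF lin]
          self_adjoint_inner[OF self_adjoint_poly_op[OF self_adjoint, of "p n"]])
    moreover have "(\<lambda>n. inner (poly_op (q n) A x) (poly_op (p n) A y))
        \<longlonglongrightarrow> inner (fun_calc g A x) (fun_calc f A y)"
      by (intro tendsto_inner fun_calc_tendsto f g p q)
    ultimately show "(\<lambda>n. inner (poly_op (p n * q n) A x) y)
        \<longlonglongrightarrow> inner (fun_calc f A (fun_calc g A x)) y"
      by (simp only: self_adjoint_inner[OF self_adjoint_fun_calc[OF f]])
  qed
  then show ?thesis by (metis vector_eq_ldot inner_commute)
qed

lemma fun_calc_poly:
  assumes f: "continuous_on {a..b} f" and q: "\<And>t. t \<in> {a..b} \<Longrightarrow> f t = poly q t"
  shows "fun_calc f A x = poly_op q A x"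
proof -
  have "uniform_limit (real_spectrum A) (\<lambda>n. poly q) f sequentially"
    using q spectrum_subset by (auto simp: uniform_limit_iff)
  from fun_calc_tendsto[OF f this] show ?thesis
    by (simp add: LIMSEQ_const_iff)
qed

end

section \<open>Powers of strictly positive operators\<close>

lemma strictly_positive_self_adjoint: "strictly_positive A \<Longrightarrow> self_adjoint A"
  by (simp add: strictly_positive_def)

lemma continuous_on_powr_pos: "0 < (a::real) \<Longrightarrow> continuous_on {a..b} (\<lambda>t. t powr s)"
  by (auto intro!: continuous_intros)

context
  fixes A :: "'a::complex_hilbert \<Rightarrow> 'a"
  assumes pos: "strictly_positive A"
begin

lemma op_powr_add: "op_powr A s (op_powr A t x) = op_powr A (s + t) x"
proof -
  obtain a b where a: "a > 0" and "real_spectrum A \<subseteq> {a..b}"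
    using strictly_positive_real_spectrum[OF pos] .
  then interpret spectral_interval A a b
    using pos by unfold_locales (auto simp: strictly_positive_def)
  show ?thesis
    by (simp only: op_powr_def powr_add fun_calc_mult[OF continuous_on_powr_pos[OF a] continuous_on_powr_pos[OF a]])
qed

lemma self_adjoint_op_powr: "self_adjoint (op_powr A s)"
proof -
  obtain a b where a: "a > 0" and "real_spectrum A \<subseteq> {a..b}"
    using strictly_positive_real_spectrum[OF pos] .
  then interpret spectral_interval A a b
    using pos by unfold_locales (auto simp: strictly_positive_def)
  show ?thesis
    by (simp only: op_powr_def self_adjoint_fun_calc[OF continuous_on_powr_pos[OF a]])
qed

lemma bounded_clinear_op_powr: "bounded_clinear (op_powr A s)"
  using self_adjoint_op_powr by (rule self_adjoint_bounded_clinear)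

lemma op_powr_zero: "op_powr A 0 x = x"
  and op_powr_one: "op_powr A 1 x = A x"
proof -
  obtain a b where a: "a > 0" and "real_spectrum A \<subseteq> {a..b}"
    using strictly_positive_real_spectrum[OF pos] .
  then interpret spectral_interval A a b
    using pos by unfold_locales (auto simp: strictly_positive_def)
  \<comment> \<open>Positivity of \<open>a\<close> is essential: \<open>0 powr 0\<close> is 0, so
    \<open>t powr 0\<close> agrees with the constant 1 only away from 0.\<close>
  have "op_powr A 0 x = poly_op [:1:] A x" "op_powr A 1 x = poly_op [:0, 1:] A x"
    unfolding op_powr_def using a
    by (intro fun_calc_poly continuous_on_powr_pos; simp)+
  then show "op_powr A 0 x = x" "op_powr A 1 x = A x"
    by (simp_all add: poly_op_const[OF lin] poly_op_X[OF lin])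
qed

lemma op_powr_minus_cancel:
  "op_powr A (- s) (op_powr A s x) = x" "op_powr A s (op_powr A (- s) x) = x"
  by (simp_all add: op_powr_add op_powr_zero)

text \<open>The power is the square of the self-adjoint \<open>op_powr A (s / 2)\<close>, so its
  form at \<open>x\<close> is the squared norm of that half power at \<open>x\<close>. The half
  power has a bounded inverse, hence is bounded below.\<close>

lemma strictly_positive_op_powr: "strictly_positive (op_powr A s)"
proof -
  let ?P = "op_powr A (s / 2)" and ?R = "op_powr A (- (s / 2))"
  define k where "k = onorm ?R + 1"
  have k: "k > 0" "onorm ?R \<le> k"
    using onorm_pos_le[OF bounded_clinear_bounded_linear[OF bounded_clinear_op_powr, of "- (s / 2)"]]
    by (auto simp: k_def)
  have "inverse (k\<^sup>2) * (norm x)\<^sup>2 \<le> inner (op_powr A s x) x" for x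
  proof -
    have "norm x = norm (?R (?P x))" by (simp add: op_powr_minus_cancel)
    also have "\<dots> \<le> onorm ?R * norm (?P x)"
      by (rule onorm) (intro bounded_clinear_bounded_linear bounded_clinear_op_powr)
    also have "\<dots> \<le> k * norm (?P x)"
      using k by (intro mult_right_mono) auto
    finally have "(norm x)\<^sup>2 \<le> (k * norm (?P x))\<^sup>2"
      by (intro power_mono) auto
    then have "inverse (k\<^sup>2) * (norm x)\<^sup>2 \<le> (norm (?P x))\<^sup>2"
      using k by (simp add: power_mult_distrib field_simps)
    also have "(norm (?P x))\<^sup>2 = inner (?P (?P x)) x"
      by (simp only: power2_norm_eq_inner self_adjoint_inner[OF self_adjoint_op_powr])
    also have "?P (?P x) = op_powr A s x"
      by (simp only: op_powr_add field_sum_of_halves)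
    finally show ?thesis .
  qed
  moreover have "inverse (k\<^sup>2) > 0" using k by simp
  ultimately show ?thesis
    unfolding strictly_positive_def using self_adjoint_op_powr by blast
qed

end

section \<open>Polar decomposition and the Aluthge transform\<close>

lemma strictly_positive_cadjoint_compose:
  fixes T :: "'a::complex_hilbert \<Rightarrow> 'a"
  assumes T: "bounded_clinear T" and inv: "invertible_op T"
  shows "strictly_positive (cadjoint T \<circ> T)"
proof -
  have "self_adjoint (cadjoint T \<circ> T)"
    using bounded_clinear_compose[OF bounded_clinear_cadjoint[OF T] T] inner_cadjoint[OF T]
    unfolding self_adjoint_def comp_def by (metis inner_commute)
  moreover obtain K where K: "\<And>x. norm (inv T x) \<le> K * norm x" "\<And>x. inv T (T x) = x"
    by (rule invertible_opE[OF inv]) (rule that)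
  define k where "k = \<bar>K\<bar> + 1"
  have k: "k > 0" "K \<le> k" by (auto simp: k_def)
  have "inverse (k\<^sup>2) * (norm x)\<^sup>2 \<le> inner ((cadjoint T \<circ> T) x) x" for x
  proof -
    have "norm x \<le> K * norm (T x)" using K(1)[of "T x"] K(2)[of x] by simp
    also have "\<dots> \<le> k * norm (T x)"
      using k by (intro mult_right_mono) auto
    finally have "(norm x)\<^sup>2 \<le> (k * norm (T x))\<^sup>2"
      by (intro power_mono) auto
    then have "inverse (k\<^sup>2) * (norm x)\<^sup>2 \<le> (norm (T x))\<^sup>2"
      using k by (simp add: power_mult_distrib field_simps)
    also have "\<dots> = inner ((cadjoint T \<circ> T) x) x"
      by (metis comp_apply inner_cadjoint[OF T] inner_commute power2_norm_eq_inner)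
    finally show ?thesis .
  qed
  moreover have "inverse (k\<^sup>2) > 0" using k by simp
  ultimately show ?thesis
    unfolding strictly_positive_def by blast
qed

context
  fixes T :: "'a::complex_hilbert \<Rightarrow> 'a"
  assumes T: "bounded_clinear T" and inv: "invertible_op T"
begin

lemma strictly_positive_op_abs: "strictly_positive (op_abs T)"
  unfolding op_abs_def
  by (rule strictly_positive_op_powr[OF strictly_positive_cadjoint_compose[OF T inv]])

text \<open>Both squared norms equal the form of \<open>cadjoint T \<circ> T\<close>. This is what
  makes \<open>T\<close> composed with the inverse of \<open>op_abs T\<close> isometric.\<close>

lemma norm_op_abs: "norm (op_abs T x) = norm (T x)"
proof -
  note pos = strictly_positive_cadjoint_compose[OF T inv]
  have "op_abs T (op_abs T x) = op_powr (cadjoint T \<circ> T) (1/2 + 1/2) x"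
    unfolding op_abs_def by (rule op_powr_add[OF pos])
  then have "op_abs T (op_abs T x) = cadjoint T (T x)"
    by (simp add: op_powr_one[OF pos])
  then have "inner (op_abs T x) (op_abs T x) = inner x (cadjoint T (T x))"
    using self_adjoint_inner[OF strictly_positive_self_adjoint[OF strictly_positive_op_abs],
        of x "op_abs T x"] by simp
  then have "inner (op_abs T x) (op_abs T x) = inner (T x) (T x)"
    by (simp add: inner_cadjoint[OF T])
  then show ?thesis by (simp add: norm_eq_sqrt_inner)
qed

text \<open>Since \<open>op_abs T\<close> is onto, the factorization determines \<open>U\<close>.
  Existence holds because the candidate is isometric on the whole space, with kernel zero like that
  of \<open>T\<close>.\<close>

lemma polar_isometry_eq: "polar_isometry T = (\<lambda>x. T (op_powr (op_abs T) (- 1) x))"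
  unfolding polar_isometry_def
proof (rule the_equality)
  let ?H = "op_abs T" and ?R = "op_powr (op_abs T) (- 1)"
  note pos = strictly_positive_op_abs
  have cancel: "?H (?R x) = x" "?R (?H x) = x" for x
    using op_powr_minus_cancel[OF pos, of 1 x] by (simp_all add: op_powr_one[OF pos])
  have inj: "T x = 0 \<longleftrightarrow> x = 0" for x
    by (metis T bounded_clinear_zero inv invertible_opE)
  have isometry: "norm (T (?R x)) = norm x" for x
    by (metis cancel(1) norm_op_abs)
  have "bounded_clinear (\<lambda>x. T (?R x))"
    by (rule bounded_clinear_compose[OF T bounded_clinear_op_powr[OF pos]])
  moreover have "{x. T (?R x) = 0} = {x. T x = 0}"
    using isometry by (metis inj norm_eq_zero)
  ultimately show "partial_isometry (\<lambda>x. T (?R x)) \<and> T = (\<lambda>x. T (?R x)) \<circ> ?H \<and>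
      {x. T (?R x) = 0} = {x. T x = 0}"
    by (simp add: partial_isometry_def isometry cancel fun_eq_iff)
  fix U assume "partial_isometry U \<and> T = U \<circ> ?H \<and> {x. U x = 0} = {x. T x = 0}"
  then have "T (?R x) = U (?H (?R x))" for x by (metis comp_apply)
  then show "U = (\<lambda>x. T (?R x))" by (simp add: cancel fun_eq_iff)
qed

lemma aluthge_eq:
  "aluthge l T = (\<lambda>x. op_powr (op_abs T) l (T (op_powr (op_abs T) (- l) x)))"
  by (simp add: aluthge_def fun_eq_iff polar_isometry_eq op_powr_add[OF strictly_positive_op_abs])

end

theorem corollary3p5:
  fixes T :: "'a::complex_hilbert \<Rightarrow> 'a"
  assumes "bounded_clinear T" and "invertible_op T"
  shows "shifted_hyperbolic T \<longleftrightarrow> (\<forall>l. 0 < l \<and> l < 1 \<longrightarrow> shifted_hyperbolic (aluthge l T))"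
proof -
  note pos = strictly_positive_op_abs[OF assms]
  have similar: "shifted_hyperbolic (aluthge l T) \<longleftrightarrow> shifted_hyperbolic T" for l
    unfolding aluthge_eq[OF assms]
    by (intro shifted_hyperbolic_similar_iff bounded_clinear_op_powr[OF pos]
        op_powr_minus_cancel[OF pos])
  \<comment> \<open>The equivalence holds for each \<open>l\<close> separately; the backward
    direction needs one exponent to apply it to.\<close>
  have "\<exists>l::real. 0 < l \<and> l < 1" by (rule dense) simp
  then show ?thesis unfolding similar by blast
qed

end
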